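(* Let $k\ge 1$ be an integer and suppose that the $k$-kernel vector satisfies $\mathbf{K}=\mathbf{M}_k^{-1}\mathbf{V}_k$. Then for every integer $n\ge 2k$, $$\tilde{\mathbf{B}}_{n,n-k}=\mathbf{Q}_{k,n}^{-1}\mathbf{V}_k .$$
   Context: Binomial coefficients: for integers $c,d$ (with $c$ possibly negative), $\binom{c}{d}=\frac{c(c-1)\cdots(c-d+1)}{d!}$ if $d\ge 0$ and $\binom{c}{d}=0$ if $d<0$. For $n\ge 2k$ let $A_{n,n-k}$ be the set of permutations $a_1a_2\cdots a_n\in S_n$ (one-line notation) with $a_1<a_2<\cdots<a_{n-k}$ and having no increasing subsequence of length greater than $n-k$. For $1\le i\le k+1$ let $B_{n,n-k}(i)=\{a_1\cdots a_n\in A_{n,n-k}: a_1=i\}$. The component vector is the column vector $\tilde{\mathbf{B}}_{n,n-k}=[\#B_{n,n-k}(1),\dots,\#B_{n,n-k}(k+1)]^T$, and the $k$-kernel is $\mathbf{K}=\tilde{\mathbf{B}}_{2k,k}=[\#B_{2k,k}(1),\dots,\#B_{2k,k}(k+1)]^T$ (the case $n=2k$). Define the column vector $\mathbf{V}_k=[v_1,\dots,v_{k+1}]^T$ by $v_i=\sum_{b\ge 0}(-1)^{k-b}\binom{k}{b}\binom{i}{b}b!$, and the $(k+1)\times(k+1)$ matrices $$\mathbf{M}_k=\left(\binom{i+j-2k-1}{j-1}\right)_{i,j=1}^{k+1},\qquad \mathbf{Q}_{k,n}=\left((-1)^{j-1}\binom{n-i-1}{j-1}\right)_{i,j=1}^{k+1}.$$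 *)

theory Defs
  imports
    "HOL-Combinatorics.Permutations"
    "Jordan_Normal_Form.Gauss_Jordan_Elimination"
begin

(* A permutation a_1 ... a_n in one-line notation is a function p permuting {1..n}, with
   a_i = p i.  An increasing subsequence is given by its set S of positions. *)
definition A_set :: "nat \<Rightarrow> nat \<Rightarrow> (nat \<Rightarrow> nat) set" where
  "A_set n m = {p. p permutes {1..n} \<and> strict_mono_on {1..m} p \<and>
     \<not> (\<exists>S \<subseteq> {1..n}. strict_mono_on S p \<and> card S > m)}"

definition B_set :: "nat \<Rightarrow> nat \<Rightarrow> nat \<Rightarrow> (nat \<Rightarrow> nat) set" where
  "B_set n m i = {p \<in> A_set n m. p 1 = i}"

(* Vectors and matrices are indexed from 0, so the mathematical indices i, j in 1..k+1
   are r + 1 and c + 1 below. *)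
definition component_vec :: "nat \<Rightarrow> nat \<Rightarrow> rat vec" where
  "component_vec k n = vec (k + 1) (\<lambda>r. of_nat (card (B_set n (n - k) (r + 1))))"

definition kernel_vec :: "nat \<Rightarrow> rat vec" where
  "kernel_vec k = component_vec k (2 * k)"

(* The terms with b > k vanish because of the factor (k choose b). *)
definition V_vec :: "nat \<Rightarrow> rat vec" where
  "V_vec k = vec (k + 1) (\<lambda>r. let i = r + 1 in
     \<Sum>b\<le>k. (-1) ^ (k - b) * of_nat (k choose b) * of_nat (i choose b) * fact b)"

(* The upper arguments of the binomial coefficients below may be negative, hence gchoose
   on rational numbers. *)
definition M_mat :: "nat \<Rightarrow> rat mat" where
  "M_mat k = mat (k + 1) (k + 1) (\<lambda>(r, c). let i = r + 1; j = c + 1 in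
     of_int (int i + int j - 2 * int k - 1) gchoose (j - 1))"

definition Q_mat :: "nat \<Rightarrow> nat \<Rightarrow> rat mat" where
  "Q_mat k n = mat (k + 1) (k + 1) (\<lambda>(r, c). let i = r + 1; j = c + 1 in
     (-1) ^ (j - 1) * (of_int (int n - int i - 1) gchoose (j - 1)))"

end

(* Deleting the first letter of a permutation and standardising the rest gives, for n \<ge> 2k,
   #B_{n+1,n+1-k}(i) = \<Sum>_{j \<ge> i} #B_{n,n-k}(j); that is, the component vectors of n and n+1
   are related by the upper triangular all-ones matrix U.  The alternating partial sum identity
   \<Sum>_{m<j} (-1)^m (x choose m) = (-1)^(j-1) (x-1 choose j-1) says that Q_{k,n} = Q_{k,n+1} U, so
   Q_{k,n} B_{n,n-k} does not depend on n.  Finally Q_{k,2k} = M_k by negating the upper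
   argument of the binomial coefficients. *)
theory Submission
  imports Defs "Jordan_Normal_Form.Determinant"
begin

section \<open>Prepending a letter to a permutation\<close>

text \<open>Values at least \<open>i\<close> move up by one to make room for the new first letter.
  The clause at 0 keeps 0 fixed. If \<open>q\<close> permutes {1..n} and i <= n + 1, positions
  beyond n + 1 are fixed as well: \<open>q\<close> fixes x - 1 >= i and the shift restores
  x.\<close>

definition prepend :: "nat \<Rightarrow> (nat \<Rightarrow> nat) \<Rightarrow> nat \<Rightarrow> nat" where
  "prepend i q x =
     (if x = 0 then 0 else if x = 1 then i
      else if i \<le> q (x - 1) then q (x - 1) + 1 else q (x - 1))"

lemma prepend_1 [simp]: "prepend i q (Suc 0) = i"
  by (simp add: prepend_def)

lemma prepend_Suc: "x > 0 \<Longrightarrow> prepend i q (Suc x) = (if i \<le> q x then q x + 1 else q x)"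
  by (simp add: prepend_def)

lemma prepend_permutes:
  assumes q: "q permutes {1..n}" and i: "i \<in> {1..Suc n}"
  shows "prepend i q permutes {1..Suc n}"
proof (rule bij_imp_permutes)
  have inj: "inj_on (prepend i q) {1..Suc n}"
  proof (rule inj_onI)
    fix x y
    assume xy: "x \<in> {1..Suc n}" "y \<in> {1..Suc n}" "prepend i q x = prepend i q y"
    have "q (x - 1) = q (y - 1) \<Longrightarrow> x - 1 = y - 1"
      using permutes_inj[OF q] by (simp add: inj_eq)
    then show "x = y"
      using xy by (auto simp: prepend_def split: if_splits)
  qed
  have "prepend i q x \<in> {1..Suc n}" if x: "x \<in> {1..Suc n}" for x
  proof (cases "x = 1")
    case False
    then have "q (x - 1) \<in> {1..n}"
      using x by (subst permutes_in_image[OF q]) auto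
    then show ?thesis
      using x False by (auto simp: prepend_def)
  qed (use i in auto)
  then have "prepend i q ` {1..Suc n} = {1..Suc n}"
    by (intro endo_inj_surj inj) auto
  with inj show "bij_betw (prepend i q) {1..Suc n} {1..Suc n}"
    by (simp add: bij_betw_def)
next
  fix x assume x: "x \<notin> {1..Suc n}"
  show "prepend i q x = x"
  proof (cases "x = 0")
    case False
    then have "q (x - 1) = x - 1"
      using x by (intro permutes_not_in[OF q]) auto
    then show ?thesis
      using x i False by (auto simp: prepend_def)
  qed (simp add: prepend_def)
qed

lemma permutes_eq_prepend:
  assumes p: "p permutes {1..Suc n}" and i: "p 1 = i"
  obtains q where "q permutes {1..n}" "p = prepend i q"
proof
  \<comment> \<open>Standardisation: drop the first letter and lower the values above
    \<open>i\<close> by one. By \<open>ne\<close> the value \<open>i\<close> does not occur again,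
    so no two values collide.\<close>
  define q where "q x = (if x = 0 then 0 else if p (x + 1) > i then p (x + 1) - 1 else p (x + 1))"
    for x
  have ne: "p (Suc x) \<noteq> i" if "x > 0" for x
    using permutes_inj[OF p] i that by (metis One_nat_def injD nat.inject less_numeral_extra(3))
  have i_le: "1 \<le> i" "i \<le> Suc n"
    using permutes_in_image[OF p, of 1] i by auto
  show "q permutes {1..n}"
  proof (rule bij_imp_permutes)
    have inj: "inj_on q {1..n}"
    proof (rule inj_onI)
      fix x y
      assume xy: "x \<in> {1..n}" "y \<in> {1..n}" "q x = q y"
      have "p (Suc x) = p (Suc y)"
        using xy ne[of x] ne[of y] by (auto simp: q_def split: if_splits)
      then show "x = y"
        using permutes_inj[OF p] by (simp add: inj_eq)
    qed
    have "q x \<in> {1..n}" if x: "x \<in> {1..n}" for x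
    proof -
      have "p (Suc x) \<in> {1..Suc n}"
        using x by (subst permutes_in_image[OF p]) auto
      then show ?thesis
        using x i_le ne[of x] by (auto simp: q_def)
    qed
    then have "q ` {1..n} = {1..n}"
      by (intro endo_inj_surj inj) auto
    with inj show "bij_betw q {1..n} {1..n}"
      by (simp add: bij_betw_def)
  next
    fix x assume x: "x \<notin> {1..n}"
    show "q x = x"
    proof (cases "x = 0")
      case False
      then have "p (Suc x) = Suc x"
        using x by (intro permutes_not_in[OF p]) auto
      then show ?thesis
        using x i_le False by (auto simp: q_def)
    qed (simp add: q_def)
  qed
  show "p = prepend i q"
  proof
    fix x
    consider "x = 0" | "x = 1" | y where "x = Suc y" "y > 0"
      by (cases x; cases "x - 1") auto
    then show "p x = prepend i q x"
    proof cases
      case 1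
      then show ?thesis
        using permutes_not_in[OF p, of 0] by (simp add: prepend_def)
    next
      case 2
      then show ?thesis using i by simp
    next
      case 3
      then show ?thesis
        using ne[of y] by (auto simp: prepend_Suc q_def)
    qed
  qed
qed

text \<open>\<open>prepend\<close> never reads \<open>q 0\<close>, so injectivity requires fixing
  that value; permutations of {1..n} all satisfy \<open>q 0 = 0\<close>.\<close>

lemma inj_on_prepend: "inj_on (prepend i) {q. q 0 = 0}"
proof (rule inj_onI, rule ext)
  fix q r x
  assume *: "q \<in> {q. q 0 = 0}" "r \<in> {q. q 0 = 0}" "prepend i q = prepend i r"
  show "q x = r x"
  proof (cases "x = 0")
    case False
    then show ?thesis
      using fun_cong[OF *(3), of "Suc x"] by (simp add: prepend_Suc split: if_splits)
  qed (use * in simp)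
qed

text \<open>The relabelling of values is strictly increasing, so it preserves order patterns.
  Position 0 is excluded because its successor carries the new letter.\<close>

lemma strict_mono_on_prepend_Suc_image:
  assumes "0 \<notin> S"
  shows "strict_mono_on (Suc ` S) (prepend i q) \<longleftrightarrow> strict_mono_on S q"
proof -
  have pos: "x > 0" if "x \<in> S" for x
    using assms that by (cases x) auto
  have "prepend i q (Suc x) < prepend i q (Suc y) \<longleftrightarrow> q x < q y" if "x \<in> S" "y \<in> S" for x y
    using that by (auto simp: prepend_Suc pos)
  then show ?thesis
    by (simp add: monotone_on_def)
qed

text \<open>The value \<open>q x\<close> ends up above the new letter \<open>i\<close> exactly when
  it is shifted, that is, when i <= q x.\<close>

lemma strict_mono_on_prepend_insert:
  assumes "0 \<notin> S"
  shows "strict_mono_on (insert 1 (Suc ` S)) (prepend i q) \<longleftrightarrow>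
    strict_mono_on S q \<and> (\<forall>x\<in>S. i \<le> q x)"
proof -
  have pos: "x > 0" if "x \<in> S" for x
    using assms that by (cases x) auto
  have "strict_mono_on (insert 1 (Suc ` S)) (prepend i q) \<longleftrightarrow>
      strict_mono_on (Suc ` S) (prepend i q) \<and> (\<forall>x\<in>S. prepend i q 1 < prepend i q (Suc x))"
    using pos by (auto simp: monotone_on_def simp del: prepend_1)
  also have "(\<forall>x\<in>S. prepend i q 1 < prepend i q (Suc x)) \<longleftrightarrow> (\<forall>x\<in>S. i \<le> q x)"
    by (auto simp: prepend_Suc pos)
  finally show ?thesis
    by (simp add: strict_mono_on_prepend_Suc_image assms)
qed

section \<open>The recursion for the component vectors\<close>

text \<open>The increasing prefix grows by one letter exactly when i <= q 1. Under this condition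
  the longest increasing subsequences that matter also grow by one, and this is where n <= 2 * m,
  i.e. n >= 2k for m = n - k, enters.\<close>

lemma prepend_in_A_set_iff:
  assumes q: "q permutes {1..n}" and i: "i \<in> {1..Suc n}" and m: "1 \<le> m" "m \<le> n" "n \<le> 2 * m"
  shows "prepend i q \<in> A_set (Suc n) (Suc m) \<longleftrightarrow> q \<in> A_set n m \<and> i \<le> q 1"
proof -
  have atLeast1: "{1..Suc m} = insert 1 (Suc ` {1..m})"
    by (auto simp: image_Suc_atLeastAtMost)
  have ge_iff: "(\<forall>x\<in>{1..m}. i \<le> q x) \<longleftrightarrow> i \<le> q 1" if "strict_mono_on {1..m} q"
  proof -
    have "q 1 \<le> q x" if "x \<in> {1..m}" for x
      using strict_mono_onD[OF \<open>strict_mono_on {1..m} q\<close>, of 1 x] that m by (cases "x = 1") auto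
    then show ?thesis
      using m by force
  qed
  have mono_iff: "strict_mono_on {1..Suc m} (prepend i q) \<longleftrightarrow>
      strict_mono_on {1..m} q \<and> i \<le> q 1"
    unfolding atLeast1 using ge_iff by (subst strict_mono_on_prepend_insert) auto
  have long_iff: "(\<exists>S\<subseteq>{1..Suc n}. strict_mono_on S (prepend i q) \<and> card S > Suc m) \<longleftrightarrow>
      (\<exists>T\<subseteq>{1..n}. strict_mono_on T q \<and> card T > m)"
    if mono: "strict_mono_on {1..m} q" and iq: "i \<le> q 1"
  proof
    assume "\<exists>S\<subseteq>{1..Suc n}. strict_mono_on S (prepend i q) \<and> card S > Suc m"
    then obtain S where S: "S \<subseteq> {1..Suc n}" "strict_mono_on S (prepend i q)" "card S > Suc m"
      by blast
    define T where "T = {x \<in> {1..n}. Suc x \<in> S}"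
    \<comment> \<open>Discarding position 1 shortens the subsequence by at most one.\<close>
    have "S \<subseteq> insert 1 (Suc ` T)"
    proof
      fix x assume "x \<in> S"
      then show "x \<in> insert 1 (Suc ` T)"
        using S(1) by (cases x; cases "x = 1") (auto simp: T_def)
    qed
    then have "card S \<le> card (insert 1 (Suc ` T))"
      by (intro card_mono) (auto simp: T_def)
    also have "\<dots> \<le> Suc (card T)"
      by (simp add: card_insert_if card_image T_def)
    finally have "card T > m"
      using S(3) by simp
    moreover have "strict_mono_on (Suc ` T) (prepend i q)"
      using S(2) by (rule monotone_on_subset) (auto simp: T_def)
    then have "strict_mono_on T q"
      by (subst (asm) strict_mono_on_prepend_Suc_image) (auto simp: T_def)
    ultimately show "\<exists>T\<subseteq>{1..n}. strict_mono_on T q \<and> card T > m"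
      by (intro exI[of _ T]) (auto simp: T_def)
  next
    assume "\<exists>T\<subseteq>{1..n}. strict_mono_on T q \<and> card T > m"
    then obtain T where T: "T \<subseteq> {1..n}" "strict_mono_on T q" "card T > m"
      by blast
    have fin: "finite T" and zero: "0 \<notin> T"
      using T(1) by (auto intro: finite_subset)
    (* A long increasing subsequence cannot start below i: it would avoid the first m positions
       and hence have length at most n - m \<le> m. *)
    have "i \<le> q x" if x: "x \<in> T" for x
    proof (rule ccontr)
      assume less: "\<not> i \<le> q x"
      have "y \<in> {Suc m..n}" if y: "y \<in> T" for y
      proof (rule ccontr)
        assume "y \<notin> {Suc m..n}"
        then have "y \<in> {1..m}"
          using y T(1) by auto
        then have iy: "i \<le> q y"
          using ge_iff[OF mono] iq by blast
        have x_m: "x \<notin> {1..m}"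
          using ge_iff[OF mono] iq less by blast
        \<comment> \<open>\<open>x\<close> lies beyond the prefix, so \<open>y\<close> precedes it,
          yet q x < i <= q y.\<close>
        then have "y < x"
          using \<open>y \<in> {1..m}\<close> x T(1) by force
        then show False
          using strict_mono_onD[OF T(2) y x] iy less by simp
      qed
      then have "card T \<le> card {Suc m..n}"
        by (intro card_mono) auto
      then show False
        using T(3) m by simp
    qed
    then have "strict_mono_on (insert 1 (Suc ` T)) (prepend i q)"
      using T(2) by (subst strict_mono_on_prepend_insert[OF zero]) auto
    moreover have "card (insert 1 (Suc ` T)) = Suc (card T)"
      using fin zero by (subst card_insert_disjoint) (auto simp: card_image)
    moreover have "insert 1 (Suc ` T) \<subseteq> {1..Suc n}"
      using T(1) by auto
    ultimately show "\<exists>S\<subseteq>{1..Suc n}. strict_mono_on S (prepend i q) \<and> card S > Suc m"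
      using T(3) by (intro exI[of _ "insert 1 (Suc ` T)"]) auto
  qed
  show ?thesis
    using prepend_permutes[OF q i] q mono_iff long_iff by (auto simp: A_set_def)
qed

text \<open>The m letters of the prefix are distinct and lie between \<open>q 1\<close> and n. For m
  = n - k the first letter is thus at most k + 1, so the component vector accounts for all of
  \<open>A_set\<close>.\<close>

lemma A_set_first_le:
  assumes q: "q \<in> A_set n m" and m: "1 \<le> m" "m \<le> n"
  shows "q 1 \<le> n - m + 1"
proof -
  have p: "q permutes {1..n}" and mono: "strict_mono_on {1..m} q"
    using q by (auto simp: A_set_def)
  have "q x \<in> {q 1..n}" if "x \<in> {1..m}" for x
  proof -
    have "q x \<in> {1..n}"
      using that m by (subst permutes_in_image[OF p]) auto
    moreover have "q 1 \<le> q x"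
      using strict_mono_onD[OF mono, of 1 x] that m by (cases "x = 1") auto
    ultimately show ?thesis by simp
  qed
  then have "card (q ` {1..m}) \<le> card {q 1..n}"
    by (intro card_mono) auto
  moreover have "card (q ` {1..m}) = m"
    by (subst card_image) (auto intro: inj_on_subset[OF permutes_inj[OF p]])
  ultimately show ?thesis
    using m by simp
qed

lemma finite_B_set [simp]: "finite (B_set n m i)"
  by (rule finite_subset[OF _ finite_permutations[of "{1..n}"]]) (auto simp: B_set_def A_set_def)

text \<open>Prepending \<open>i\<close> is a bijection onto the left-hand set from the words in
  \<open>A_set n (n - k)\<close> with first letter at least \<open>i\<close>; these are then sorted
  by their first letter, which is at most k + 1.\<close>

lemma card_B_set_Suc:
  assumes k: "1 \<le> k" "2 * k \<le> n" and i: "i \<in> {1..k + 1}"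
  shows "card (B_set (Suc n) (Suc n - k) i) = (\<Sum>j = i..k + 1. card (B_set n (n - k) j))"
proof -
  let ?B = "\<Union>j\<in>{i..k + 1}. B_set n (n - k) j"
  have m: "1 \<le> n - k" "n - k \<le> n" "n \<le> 2 * (n - k)" "Suc n - k = Suc (n - k)"
    and i': "i \<in> {1..Suc n}"
    using k i by auto
  have B_iff: "q \<in> ?B \<longleftrightarrow> q \<in> A_set n (n - k) \<and> i \<le> q 1" for q
    using A_set_first_le[OF _ m(1,2), of q] k by (auto simp: B_set_def)
  have "prepend i ` ?B = B_set (Suc n) (Suc n - k) i"
  proof (intro equalityI subsetI)
    fix p assume "p \<in> prepend i ` ?B"
    then obtain q where q: "p = prepend i q" "q \<in> A_set n (n - k)" "i \<le> q 1"
      using B_iff by blast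
    then have "q permutes {1..n}"
      by (simp add: A_set_def)
    with q show "p \<in> B_set (Suc n) (Suc n - k) i"
      using prepend_in_A_set_iff[OF _ i' m(1-3)] m(4) by (simp add: B_set_def)
  next
    fix p assume "p \<in> B_set (Suc n) (Suc n - k) i"
    then have p: "p \<in> A_set (Suc n) (Suc (n - k))" "p 1 = i"
      using m(4) by (simp_all add: B_set_def)
    then have "p permutes {1..Suc n}"
      by (simp add: A_set_def)
    then obtain q where q: "q permutes {1..n}" "p = prepend i q"
      using permutes_eq_prepend p(2) by blast
    then have "q \<in> ?B"
      using prepend_in_A_set_iff[OF q(1) i' m(1-3)] p(1) unfolding B_iff by simp
    with q(2) show "p \<in> prepend i ` ?B"
      by blast
  qed
  moreover have "inj_on (prepend i) ?B"
    by (rule inj_on_subset[OF inj_on_prepend])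
      (auto simp: B_set_def A_set_def intro: permutes_not_in)
  ultimately have "card (B_set (Suc n) (Suc n - k) i) = card ?B"
    by (metis card_image)
  also have "\<dots> = (\<Sum>j = i..k + 1. card (B_set n (n - k) j))"
    by (rule card_UN_disjoint) (simp_all, auto simp: B_set_def)
  finally show ?thesis .
qed

section \<open>The matrix identities\<close>

definition upper_ones :: "nat \<Rightarrow> rat mat" where
  "upper_ones d = mat d d (\<lambda>(r, c). if r \<le> c then 1 else 0)"

lemma upper_ones_carrier [simp]: "upper_ones d \<in> carrier_mat d d"
  by (simp add: upper_ones_def)

lemma Q_mat_carrier [simp]: "Q_mat k n \<in> carrier_mat (k + 1) (k + 1)"
  by (simp add: Q_mat_def)

lemma component_vec_Suc:
  assumes "1 \<le> k" "2 * k \<le> n"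
  shows "component_vec k (Suc n) = upper_ones (k + 1) *\<^sub>v component_vec k n"
proof (rule eq_vecI)
  fix r assume "r < dim_vec (upper_ones (k + 1) *\<^sub>v component_vec k n)"
  then have r: "r < k + 1"
    by (simp add: upper_ones_def)
  let ?b = "\<lambda>j. of_nat (card (B_set n (n - k) j)) :: rat"
  have "(upper_ones (k + 1) *\<^sub>v component_vec k n) $ r =
      (\<Sum>c = 0..<k + 1. (if r \<le> c then 1 else 0) * ?b (c + 1))"
    using r by (simp add: scalar_prod_def upper_ones_def component_vec_def)
  also have "\<dots> = (\<Sum>c = r..k. ?b (c + 1))"
    by (rule sum.mono_neutral_cong_right) auto
  also have "\<dots> = (\<Sum>j = r + 1..k + 1. ?b j)"
    using sum.shift_bounds_cl_Suc_ivl[of ?b r k] by simp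
  also have "\<dots> = component_vec k (Suc n) $ r"
    using r card_B_set_Suc[OF assms, of "r + 1"] by (simp add: component_vec_def)
  finally show "component_vec k (Suc n) $ r = (upper_ones (k + 1) *\<^sub>v component_vec k n) $ r"
    by simp
qed (simp add: component_vec_def upper_ones_def)

lemma Q_mat_eq_Suc: "Q_mat k n = Q_mat k (Suc n) * upper_ones (k + 1)"
proof (rule eq_matI)
  fix r c
  assume "r < dim_row (Q_mat k (Suc n) * upper_ones (k + 1))"
    and "c < dim_col (Q_mat k (Suc n) * upper_ones (k + 1))"
  then have rc: "r < k + 1" "c < k + 1"
    by (simp_all add: upper_ones_def Q_mat_def)
  \<comment> \<open>The upper argument in row r of \<open>Q_mat k (Suc n)\<close>; the one for
    \<open>Q_mat k n\<close> is \<open>?x - 1\<close>. Column c of \<open>upper_ones\<close>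
    truncates the row sum at m = c.\<close>
  let ?x = "of_int (int n - int r - 1) :: rat"
  have "(Q_mat k (Suc n) * upper_ones (k + 1)) $$ (r, c) =
      (\<Sum>m = 0..<k + 1. (-1) ^ m * (?x gchoose m) * (if m \<le> c then 1 else 0))"
    using rc
    by (auto simp: scalar_prod_def upper_ones_def Q_mat_def diff_diff_eq add.commute intro!: sum.cong)
  also have "\<dots> = (\<Sum>m\<le>c. (?x gchoose m) * (-1) ^ m)"
    using rc by (intro sum.mono_neutral_cong_right) auto
  also have "\<dots> = (-1) ^ c * (?x - 1 gchoose c)"
    by (rule gbinomial_sum_lower_neg)
  also have "\<dots> = Q_mat k n $$ (r, c)"
    using rc by (simp add: Q_mat_def algebra_simps)
  finally show "Q_mat k n $$ (r, c) = (Q_mat k (Suc n) * upper_ones (k + 1)) $$ (r, c)"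
    by simp
qed (simp_all add: Q_mat_def upper_ones_def)

lemma M_mat_eq_Q_mat: "M_mat k = Q_mat k (2 * k)"
proof (rule eq_matI)
  fix r c
  assume "r < dim_row (Q_mat k (2 * k))" "c < dim_col (Q_mat k (2 * k))"
  then show "M_mat k $$ (r, c) = Q_mat k (2 * k) $$ (r, c)"
    \<comment> \<open>With a = r + c + 1 - 2k, the upper argument of M, negation gives c - a - 1 =
      2k - r - 2, the upper argument of Q.\<close>
    using gbinomial_negated_upper[of "of_int (int r + int c + 1 - 2 * int k) :: rat" c]
    by (simp add: M_mat_def Q_mat_def algebra_simps)
qed (simp_all add: M_mat_def Q_mat_def)

text \<open>A right inverse of a square matrix over a field is two-sided, which excludes
  \<open>None\<close>; uniqueness of inverses then determines the computed matrix.\<close>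

lemma mat_inverse_SomeI:
  fixes A :: "'a::field mat"
  assumes A: "A \<in> carrier_mat d d" and B: "B \<in> carrier_mat d d" and AB: "A * B = 1\<^sub>m d"
  shows "mat_inverse A = Some B"
proof (cases "mat_inverse A")
  case None
  have "B * A = 1\<^sub>m d"
    using mat_mult_left_right_inverse[OF A B AB] .
  then show ?thesis
    \<comment> \<open>\<open>()\<close> instantiates the extension slot of the ring record in which
      \<open>A\<close> would be a unit.\<close>
    using mat_inverse(1)[OF A None, of "()"] A B AB by (auto simp: Units_def ring_mat_def)
next
  case (Some C)
  have C: "C * A = 1\<^sub>m d" "C \<in> carrier_mat d d"
    using mat_inverse(2)[OF A Some] by auto
  have "C = C * (A * B)"
    using C AB by simp
  also have "\<dots> = B"
    using C A B by (simp flip: assoc_mult_mat)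
  finally show ?thesis
    using Some by simp
qed

theorem lemma3p2:
  fixes k :: nat
  assumes "k \<ge> 1"
    and "\<exists>M_inv. mat_inverse (M_mat k) = Some M_inv \<and> kernel_vec k = M_inv *\<^sub>v V_vec k"
  shows "\<forall>n::nat. n \<ge> 2 * k \<longrightarrow>
    (\<exists>Q_inv. mat_inverse (Q_mat k n) = Some Q_inv \<and> component_vec k n = Q_inv *\<^sub>v V_vec k)"
proof (intro allI impI)
  fix n :: nat
  assume "2 * k \<le> n"
  then show "\<exists>Q_inv. mat_inverse (Q_mat k n) = Some Q_inv \<and> component_vec k n = Q_inv *\<^sub>v V_vec k"
  proof (induction n rule: dec_induct)
    case base
    then show ?case
      using assms(2) by (simp add: M_mat_eq_Q_mat kernel_vec_def)
  next
    case (step n)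
    let ?U = "upper_ones (k + 1)"
    from step.IH obtain P where P: "mat_inverse (Q_mat k n) = Some P"
      "component_vec k n = P *\<^sub>v V_vec k"
      by blast
    have inv: "Q_mat k n * P = 1\<^sub>m (k + 1)" "P \<in> carrier_mat (k + 1) (k + 1)"
      using mat_inverse(2)[OF Q_mat_carrier P(1)] by auto
    \<comment> \<open>Invertibility is carried along by the induction: from Q_n = Q_{n+1} U and Q_n
      P = 1, the matrix U P is a right inverse of Q_{n+1}.\<close>
    have "Q_mat k (Suc n) * (?U * P) = 1\<^sub>m (k + 1)"
      using inv(1) unfolding Q_mat_eq_Suc[of k n]
      by (subst (asm) assoc_mult_mat[OF Q_mat_carrier upper_ones_carrier inv(2)])
    then have "mat_inverse (Q_mat k (Suc n)) = Some (?U * P)"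
      by (intro mat_inverse_SomeI[OF Q_mat_carrier] mult_carrier_mat[OF upper_ones_carrier inv(2)])
    moreover have "component_vec k (Suc n) = (?U * P) *\<^sub>v V_vec k"
      using component_vec_Suc[OF assms(1) step.hyps(1)] P(2)
        assoc_mult_mat_vec[OF upper_ones_carrier inv(2), of "V_vec k"]
      by (simp add: V_vec_def)
    ultimately show ?case
      by blast
  qed
qed

end
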